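(* Let $\alpha\ge 0$ and $\Delta t>0$, and let $\mathcal L$, $\mathcal M$ be linear, self-adjoint, non-negative operators with respect to the $L^2(\Omega)$ inner product. Let $F$ be the potential and $f=F'$. For each time level $n$ let $F^n$ be an (arbitrary) approximation of $F(\phi)$ at time $t_n$. Consider the following two schemes. (RLM-BDF1) Given $(\phi^n,q^n)$ find $(\phi^{n+1},q^{n+1})$ such that $$\frac{\phi^{n+1}-\phi^n}{\Delta t}=-\mathcal M\mu^{n+1},\qquad \mu^{n+1}=\mathcal L\phi^{n+1}+q^{n+1}f(\phi^n),$$ $$\int_\Omega\frac{F^{n+1}-F^n}{\Delta t}\,d\mathbf x+\alpha\frac{(q^{n+1})^2-(q^n)^2}{\Delta t}=q^{n+1}\int_\Omega f(\phi^n)\frac{\phi^{n+1}-\phi^n}{\Delta t}\,d\mathbf x.$$ (RLM-CN) Given $(\phi^n,q^n)$ and $\phi^{n-1}$ find $(\phi^{n+1},q^{n+1})$ such that $$\frac{\phi^{n+1}-\phi^n}{\Delta t}=-\mathcal M\mu^{n+\frac12},\qquad \mu^{n+\frac12}=\mathcal L\phi^{n+\frac12}+q^{n+\frac12}f(\overline\phi^{\,n+\frac12}),$$ $$\int_\Omega\frac{F^{n+1}-F^n}{\Delta t}\,d\mathbf x+\alpha\frac{(q^{n+1})^2-(q^n)^2}{\Delta t}=q^{n+\frac12}\int_\Omega f(\overline\phi^{\,n+\frac12})\frac{\phi^{n+1}-\phi^n}{\Delta t}\,d\mathbf x.$$ Assume that at each time step the discrete system admits a solution $(\phi^{n+1},q^{n+1})$.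 Then both schemes are energy-stable, in the sense that $$\tilde E(\phi^{n+1},q^{n+1})-\tilde E(\phi^n,q^n)\le 0,$$ where $$\tilde E(\phi^n,q^n)=\frac12\|\phi^n\|_{\mathcal L}^2+\int_\Omega F^n\,d\mathbf x+\alpha\big[(q^n)^2-1\big].$$
   Context: $\Omega\subset\mathbb R^d$ is a bounded domain, $(u,v)=\int_\Omega uv\,d\mathbf x$ is the $L^2(\Omega)$ inner product, and for a linear self-adjoint non-negative operator $\mathcal A$ one writes $(u,v)_{\mathcal A}=(\mathcal A u,v)$ and $\|u\|_{\mathcal A}=\sqrt{(u,u)_{\mathcal A}}$ (a semi-norm). The schemes discretize the phase-field equation $\partial_t\phi=-\mathcal M\mu$, $\mu=\mathcal L\phi+f(\phi)$, associated with the free energy $E(\phi)=\frac12\|\phi\|_{\mathcal L}^2+\int_\Omega F(\phi)\,d\mathbf x$. Here $F$ is a nonlinear scalar potential function with derivative $f=F'$, $\mathcal L$ is a linear self-adjoint elliptic operator (e.g. $-\varepsilon^2\Delta$) and $\mathcal M\ge0$ is the mobility operator. Both are linear, self-adjoint and non-negative with respect to the $L^2$ inner product, the boundary conditions (homogeneous Neumann or periodic) are such that all integration-by-parts identities used in the energy estimates are valid, and all functions are sufficiently regular for the expressions involved to make sense. Time is discretized by $t_n=n\Delta t$; $\phi^n=\phi^n(\mathbf x)$ is the numerical solution at $t_n$, and $q^n\in\mathbb R$ is a scalar, with $q^0=1$. Notation: $\phi^{n+\frac12}=\frac12(\phi^n+\phi^{n+1})$, $q^{n+\frac12}=\frac12(q^n+q^{n+1})$,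 $\overline\phi^{\,n+\frac12}=\frac32\phi^n-\frac12\phi^{n-1}$. Any starting values at earlier time levels needed for extrapolation are assumed available. The functions $F^n$ are integrable functions on $\Omega$ (for example $F^n=F(\phi^n)$); the same $F^n$ appears in the scheme and in $\tilde E(\phi^n,q^n)$. *)

theory Defs
  imports "HOL-Analysis.Analysis"
begin

section \<open>Operators on square integrable functions\<close>

text \<open>Elements of $L^2(\Omega)$ are represented by functions, and identities between them are
  required only almost everywhere on the domain.\<close>

definition L2_on :: "(real^'d) set \<Rightarrow> (real^'d \<Rightarrow> real) set" where
  "L2_on \<Omega> = {u. u \<in> borel_measurable (lebesgue_on \<Omega>) \<and>
                 integrable (lebesgue_on \<Omega>) (\<lambda>x. (u x)\<^sup>2)}"

definition L2_inner :: "(real^'d) set \<Rightarrow> (real^'d \<Rightarrow> real) \<Rightarrow> (real^'d \<Rightarrow> real) \<Rightarrow> real" where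
  "L2_inner \<Omega> u v = (LINT x|lebesgue_on \<Omega>. u x * v x)"

text \<open>The operators (such as $-\varepsilon^2\Delta$) are in general unbounded, so each comes with a
  domain \<open>D\<close>, a linear space of functions that are regular enough for \<open>A\<close> to be applied and
  that satisfy the boundary conditions.\<close>

definition linear_operator_on ::
  "(real^'d) set \<Rightarrow> (real^'d \<Rightarrow> real) set \<Rightarrow> ((real^'d \<Rightarrow> real) \<Rightarrow> (real^'d \<Rightarrow> real)) \<Rightarrow> bool" where
  "linear_operator_on \<Omega> D A \<longleftrightarrow>
     D \<subseteq> L2_on \<Omega> \<and> A ` D \<subseteq> L2_on \<Omega> \<and>
     (\<lambda>x. 0) \<in> D \<and>
     (\<forall>u\<in>D. \<forall>v\<in>D. (\<lambda>x. u x + v x) \<in> D \<and>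
        (AE x in lebesgue_on \<Omega>. A (\<lambda>x. u x + v x) x = A u x + A v x)) \<and>
     (\<forall>c. \<forall>u\<in>D. (\<lambda>x. c * u x) \<in> D \<and>
        (AE x in lebesgue_on \<Omega>. A (\<lambda>x. c * u x) x = c * A u x))"

text \<open>Self-adjointness is meant in the sense of integration by parts on \<open>D\<close>.
  The domain need not be maximal, so both $-\varepsilon^2\Delta$ on smooth functions with Neumann
  or periodic boundary conditions and its self-adjoint extension in $L^2(\Omega)$ qualify.\<close>

definition self_adjoint_on ::
  "(real^'d) set \<Rightarrow> (real^'d \<Rightarrow> real) set \<Rightarrow> ((real^'d \<Rightarrow> real) \<Rightarrow> (real^'d \<Rightarrow> real)) \<Rightarrow> bool" where
  "self_adjoint_on \<Omega> D A \<longleftrightarrow> (\<forall>u\<in>D. \<forall>v\<in>D. L2_inner \<Omega> (A u) v = L2_inner \<Omega> u (A v))"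

definition nonnegative_on ::
  "(real^'d) set \<Rightarrow> (real^'d \<Rightarrow> real) set \<Rightarrow> ((real^'d \<Rightarrow> real) \<Rightarrow> (real^'d \<Rightarrow> real)) \<Rightarrow> bool" where
  "nonnegative_on \<Omega> D A \<longleftrightarrow> (\<forall>u\<in>D. L2_inner \<Omega> (A u) u \<ge> 0)"

definition op_inner ::
  "(real^'d) set \<Rightarrow> ((real^'d \<Rightarrow> real) \<Rightarrow> (real^'d \<Rightarrow> real)) \<Rightarrow>
     (real^'d \<Rightarrow> real) \<Rightarrow> (real^'d \<Rightarrow> real) \<Rightarrow> real" where
  "op_inner \<Omega> A u v = L2_inner \<Omega> (A u) v"

definition op_norm ::
  "(real^'d) set \<Rightarrow> ((real^'d \<Rightarrow> real) \<Rightarrow> (real^'d \<Rightarrow> real)) \<Rightarrow> (real^'d \<Rightarrow> real) \<Rightarrow> real" where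
  "op_norm \<Omega> A u = sqrt (op_inner \<Omega> A u u)"


section \<open>The schemes and the modified energy\<close>

text \<open>Time levels are integers; level $-1$ is used only for the starting value $\phi^{-1}$ of the
  extrapolation. The time step is \<open>dt\<close>.\<close>

definition phi_half :: "(int \<Rightarrow> real^'d \<Rightarrow> real) \<Rightarrow> int \<Rightarrow> real^'d \<Rightarrow> real" where
  "phi_half \<phi> n = (\<lambda>x. 1/2 * (\<phi> n x + \<phi> (n+1) x))"

definition q_half :: "(int \<Rightarrow> real) \<Rightarrow> int \<Rightarrow> real" where
  "q_half q n = 1/2 * (q n + q (n+1))"

definition phi_bar :: "(int \<Rightarrow> real^'d \<Rightarrow> real) \<Rightarrow> int \<Rightarrow> real^'d \<Rightarrow> real" where
  "phi_bar \<phi> n = (\<lambda>x. 3/2 * \<phi> n x - 1/2 * \<phi> (n-1) x)"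

text \<open>\<open>rlm_bdf1\<close> and \<open>rlm_cn\<close> say that level $n+1$ solves the respective discrete system with
  data from the levels up to $n$. The membership and integrability conjuncts are the
  regularity needed for the expressions in the system to make sense.\<close>

definition rlm_bdf1 ::
  "(real^'d) set \<Rightarrow> (real^'d \<Rightarrow> real) set \<Rightarrow> ((real^'d \<Rightarrow> real) \<Rightarrow> (real^'d \<Rightarrow> real)) \<Rightarrow>
   (real^'d \<Rightarrow> real) set \<Rightarrow> ((real^'d \<Rightarrow> real) \<Rightarrow> (real^'d \<Rightarrow> real)) \<Rightarrow>
   (real \<Rightarrow> real) \<Rightarrow> real \<Rightarrow> real \<Rightarrow> (int \<Rightarrow> real^'d \<Rightarrow> real) \<Rightarrow>
   (int \<Rightarrow> real^'d \<Rightarrow> real) \<Rightarrow> (int \<Rightarrow> real) \<Rightarrow> int \<Rightarrow> bool" where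
  "rlm_bdf1 \<Omega> D\<^sub>L L D\<^sub>M M f \<alpha> dt Fn \<phi> q n \<longleftrightarrow>
     \<phi> n \<in> D\<^sub>L \<and> \<phi> (n+1) \<in> D\<^sub>L \<and>
     integrable (lebesgue_on \<Omega>) (\<lambda>x. f (\<phi> n x) * ((\<phi> (n+1) x - \<phi> n x) / dt)) \<and>
     (\<exists>\<mu>\<in>D\<^sub>M.
        (AE x in lebesgue_on \<Omega>. (\<phi> (n+1) x - \<phi> n x) / dt = - M \<mu> x) \<and>
        (AE x in lebesgue_on \<Omega>. \<mu> x = L (\<phi> (n+1)) x + q (n+1) * f (\<phi> n x))) \<and>
     (LINT x|lebesgue_on \<Omega>. (Fn (n+1) x - Fn n x) / dt) + \<alpha> * (((q (n+1))\<^sup>2 - (q n)\<^sup>2) / dt)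
       = q (n+1) * (LINT x|lebesgue_on \<Omega>. f (\<phi> n x) * ((\<phi> (n+1) x - \<phi> n x) / dt))"

definition rlm_cn ::
  "(real^'d) set \<Rightarrow> (real^'d \<Rightarrow> real) set \<Rightarrow> ((real^'d \<Rightarrow> real) \<Rightarrow> (real^'d \<Rightarrow> real)) \<Rightarrow>
   (real^'d \<Rightarrow> real) set \<Rightarrow> ((real^'d \<Rightarrow> real) \<Rightarrow> (real^'d \<Rightarrow> real)) \<Rightarrow>
   (real \<Rightarrow> real) \<Rightarrow> real \<Rightarrow> real \<Rightarrow> (int \<Rightarrow> real^'d \<Rightarrow> real) \<Rightarrow>
   (int \<Rightarrow> real^'d \<Rightarrow> real) \<Rightarrow> (int \<Rightarrow> real) \<Rightarrow> int \<Rightarrow> bool" where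
  "rlm_cn \<Omega> D\<^sub>L L D\<^sub>M M f \<alpha> dt Fn \<phi> q n \<longleftrightarrow>
     \<phi> n \<in> D\<^sub>L \<and> \<phi> (n+1) \<in> D\<^sub>L \<and>
     integrable (lebesgue_on \<Omega>) (\<lambda>x. f (phi_bar \<phi> n x) * ((\<phi> (n+1) x - \<phi> n x) / dt)) \<and>
     (\<exists>\<mu>\<in>D\<^sub>M.
        (AE x in lebesgue_on \<Omega>. (\<phi> (n+1) x - \<phi> n x) / dt = - M \<mu> x) \<and>
        (AE x in lebesgue_on \<Omega>. \<mu> x = L (phi_half \<phi> n) x + q_half q n * f (phi_bar \<phi> n x))) \<and>
     (LINT x|lebesgue_on \<Omega>. (Fn (n+1) x - Fn n x) / dt) + \<alpha> * (((q (n+1))\<^sup>2 - (q n)\<^sup>2) / dt)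
       = q_half q n * (LINT x|lebesgue_on \<Omega>. f (phi_bar \<phi> n x) * ((\<phi> (n+1) x - \<phi> n x) / dt))"

definition rlm_energy ::
  "(real^'d) set \<Rightarrow> ((real^'d \<Rightarrow> real) \<Rightarrow> (real^'d \<Rightarrow> real)) \<Rightarrow> real \<Rightarrow>
   (int \<Rightarrow> real^'d \<Rightarrow> real) \<Rightarrow> (int \<Rightarrow> real^'d \<Rightarrow> real) \<Rightarrow> (int \<Rightarrow> real) \<Rightarrow> int \<Rightarrow> real" where
  "rlm_energy \<Omega> L \<alpha> Fn \<phi> q n =
     1/2 * (op_norm \<Omega> L (\<phi> n))\<^sup>2 + (LINT x|lebesgue_on \<Omega>. Fn n x) + \<alpha> * ((q n)\<^sup>2 - 1)"

end

theory Submission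
  imports Defs
begin

text \<open>Pairing the evolution equation with \<open>\<mu>\<close> gives
  $(\mathcal L w, \delta) + r\,(g, \delta) = -\Delta t\,(\mu, \mathcal M\mu) \le 0$, where
  $\delta = \phi^{n+1} - \phi^n$ and \<open>w\<close>, \<open>r\<close>, \<open>g\<close> are the values of $\phi$, $q$, $f$ used by the
  scheme. The scalar equation identifies $r\,(g, \delta)$ with the increment of
  $\int F^n + \alpha (q^n)^2$. Finally
  $(\mathcal L w, \delta) \ge \frac12\|\phi^{n+1}\|_{\mathcal L}^2 - \frac12\|\phi^n\|_{\mathcal L}^2$,
  with equality for $w = \phi^{n+1/2}$ and gap $\frac12\|\delta\|_{\mathcal L}^2$ for
  $w = \phi^{n+1}$.\<close>

text \<open>The product is dominated by the sum of squares, which is integrable by the definition of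
  \<open>L2_on\<close>.\<close>

lemma L2_on_integrable_mult:
  assumes "u \<in> L2_on \<Omega>" and "v \<in> L2_on \<Omega>"
  shows "integrable (lebesgue_on \<Omega>) (\<lambda>x. u x * v x)"
proof (rule Bochner_Integration.integrable_bound)
  show "integrable (lebesgue_on \<Omega>) (\<lambda>x. (u x)\<^sup>2 + (v x)\<^sup>2)"
    using assms by (simp add: L2_on_def)
  show "(\<lambda>x. u x * v x) \<in> borel_measurable (lebesgue_on \<Omega>)"
    using assms by (auto simp: L2_on_def)
  have "\<bar>a * b\<bar> \<le> a\<^sup>2 + b\<^sup>2" for a b :: real
  proof -
    \<comment> \<open>\<open>sum_squares_bound\<close> controls twice the product; this sign fact
      allows dropping the factor 2.\<close>
    have "0 \<le> \<bar>a\<bar> * \<bar>b\<bar>"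
      by simp
    then show ?thesis
      using sum_squares_bound[of "\<bar>a\<bar>" "\<bar>b\<bar>"] by (simp only: abs_mult power2_abs)
  qed
  then show "AE x in lebesgue_on \<Omega>. norm (u x * v x) \<le> norm ((u x)\<^sup>2 + (v x)\<^sup>2)"
    by simp
qed

lemma L2_inner_cong_AE:
  assumes "A \<in> borel_measurable (lebesgue_on \<Omega>)" and "B \<in> borel_measurable (lebesgue_on \<Omega>)"
    and "w \<in> borel_measurable (lebesgue_on \<Omega>)"
    and "AE x in lebesgue_on \<Omega>. A x = B x"
  shows "L2_inner \<Omega> A w = L2_inner \<Omega> B w"
  unfolding L2_inner_def using assms by (intro integral_cong_AE) auto

lemma L2_inner_commute: "L2_inner \<Omega> u v = L2_inner \<Omega> v u"
  by (simp add: L2_inner_def mult.commute)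

lemma L2_inner_lincomb:
  assumes "u \<in> L2_on \<Omega>" and "v \<in> L2_on \<Omega>" and "w \<in> L2_on \<Omega>"
  shows "L2_inner \<Omega> (\<lambda>x. a * u x + b * v x) w = a * L2_inner \<Omega> u w + b * L2_inner \<Omega> v w"
proof -
  have "L2_inner \<Omega> (\<lambda>x. a * u x + b * v x) w
      = (LINT x|lebesgue_on \<Omega>. a * (u x * w x) + b * (v x * w x))"
    unfolding L2_inner_def by (simp add: algebra_simps)
  then show ?thesis
    unfolding L2_inner_def using assms by (simp add: L2_on_integrable_mult)
qed

lemma linear_operator_on_L2:
  assumes "linear_operator_on \<Omega> D A" and "u \<in> D"
  shows "u \<in> L2_on \<Omega>" and "A u \<in> L2_on \<Omega>"
  using assms unfolding linear_operator_on_def by auto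

lemma linear_operator_on_lincomb:
  assumes A: "linear_operator_on \<Omega> D A" and u: "u \<in> D" and v: "v \<in> D"
  shows "(\<lambda>x. a * u x + b * v x) \<in> D"
    and "AE x in lebesgue_on \<Omega>. A (\<lambda>x. a * u x + b * v x) x = a * A u x + b * A v x"
proof -
  have au: "(\<lambda>x. a * u x) \<in> D" "AE x in lebesgue_on \<Omega>. A (\<lambda>x. a * u x) x = a * A u x"
    using A u unfolding linear_operator_on_def by auto
  have bv: "(\<lambda>x. b * v x) \<in> D" "AE x in lebesgue_on \<Omega>. A (\<lambda>x. b * v x) x = b * A v x"
    using A v unfolding linear_operator_on_def by auto
  have *: "\<forall>u\<in>D. \<forall>v\<in>D. (\<lambda>x. u x + v x) \<in> D \<and>
      (AE x in lebesgue_on \<Omega>. A (\<lambda>x. u x + v x) x = A u x + A v x)"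
    using A unfolding linear_operator_on_def by blast
  note s = *[rule_format, OF au(1) bv(1)]
  show "(\<lambda>x. a * u x + b * v x) \<in> D"
    using s by simp
  have "AE x in lebesgue_on \<Omega>. A (\<lambda>x. a * u x + b * v x) x
      = A (\<lambda>x. a * u x) x + A (\<lambda>x. b * v x) x"
    using s by simp
  with au(2) bv(2)
  show "AE x in lebesgue_on \<Omega>. A (\<lambda>x. a * u x + b * v x) x = a * A u x + b * A v x"
    by eventually_elim simp
qed

text \<open>Linearity of \<open>A\<close> holds only almost everywhere, so it is used under the
  integral, where null sets are invisible.\<close>

lemma op_inner_lincomb_left:
  assumes A: "linear_operator_on \<Omega> D A" and u: "u \<in> D" and v: "v \<in> D" and w: "w \<in> D"
  shows "op_inner \<Omega> A (\<lambda>x. a * u x + b * v x) w = a * op_inner \<Omega> A u w + b * op_inner \<Omega> A v w"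
proof -
  note L2 = linear_operator_on_L2[OF A]
  note lc = linear_operator_on_lincomb[OF A u v, of a b]
  have "L2_inner \<Omega> (A (\<lambda>x. a * u x + b * v x)) w = L2_inner \<Omega> (\<lambda>x. a * A u x + b * A v x) w"
    using L2(2)[OF lc(1)] L2(2)[OF u] L2(2)[OF v] L2(1)[OF w]
    by (intro L2_inner_cong_AE lc(2)) (auto simp: L2_on_def)
  then show ?thesis
    unfolding op_inner_def using L2_inner_lincomb L2 u v w by metis
qed

text \<open>Here \<open>A w\<close> is a fixed square integrable function, so linearity comes from
  the integral, after swapping the two factors.\<close>

lemma op_inner_lincomb_right:
  assumes A: "linear_operator_on \<Omega> D A" and u: "u \<in> D" and v: "v \<in> D" and w: "w \<in> D"
  shows "op_inner \<Omega> A w (\<lambda>x. a * u x + b * v x) = a * op_inner \<Omega> A w u + b * op_inner \<Omega> A w v"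
  using L2_inner_lincomb[OF linear_operator_on_L2(1)[OF A u] linear_operator_on_L2(1)[OF A v]
      linear_operator_on_L2(2)[OF A w]]
  unfolding op_inner_def by (metis L2_inner_commute)

lemma op_inner_commute:
  assumes "self_adjoint_on \<Omega> D A" and "u \<in> D" and "v \<in> D"
  shows "op_inner \<Omega> A u v = op_inner \<Omega> A v u"
  using assms unfolding op_inner_def self_adjoint_on_def by (metis L2_inner_commute)

text \<open>In HOL the square of \<open>sqrt x\<close> is the absolute value of \<open>x\<close>;
  nonnegativity of \<open>A\<close> removes the absolute value.\<close>

lemma op_norm_power2:
  assumes "nonnegative_on \<Omega> D A" and "u \<in> D"
  shows "(op_norm \<Omega> A u)\<^sup>2 = op_inner \<Omega> A u u"
  using assms by (simp add: op_norm_def op_inner_def nonnegative_on_def)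

text \<open>Expand the nonnegative form \<open>op_inner\<close> at the difference of
  \<open>v\<close> and \<open>u\<close>; self-adjointness merges the two mixed terms, and half of
  the resulting inequality rearranges to the claim.\<close>

lemma op_inner_implicit_ge:
  assumes A: "linear_operator_on \<Omega> D A" and sa: "self_adjoint_on \<Omega> D A"
    and nn: "nonnegative_on \<Omega> D A" and u: "u \<in> D" and v: "v \<in> D"
  shows "1/2 * (op_norm \<Omega> A v)\<^sup>2 - 1/2 * (op_norm \<Omega> A u)\<^sup>2 \<le> op_inner \<Omega> A v (\<lambda>x. v x - u x)"
proof -
  \<comment> \<open>The difference is spelled with explicit coefficients so that the lemmas on
    linear combinations rewrite it directly.\<close>
  let ?d = "\<lambda>x. 1 * v x + (- 1) * u x"
  have d: "?d \<in> D"
    by (rule linear_operator_on_lincomb(1)[OF A v u])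
  have "0 \<le> op_inner \<Omega> A ?d ?d"
    using nn d unfolding nonnegative_on_def op_inner_def by blast
  also have "\<dots> = op_inner \<Omega> A v v - 2 * op_inner \<Omega> A v u + op_inner \<Omega> A u u"
    unfolding op_inner_lincomb_left[OF A v u d] op_inner_lincomb_right[OF A v u v]
      op_inner_lincomb_right[OF A v u u] op_inner_commute[OF sa u v] by simp
  finally show ?thesis
    using op_inner_lincomb_right[OF A v u v, of 1 "- 1"]
    by (simp add: op_norm_power2[OF nn u] op_norm_power2[OF nn v])
qed

text \<open>A difference of squares for a symmetric form: the mixed terms cancel by
  self-adjointness, so equality holds.\<close>

lemma op_inner_midpoint:
  assumes A: "linear_operator_on \<Omega> D A" and sa: "self_adjoint_on \<Omega> D A"
    and nn: "nonnegative_on \<Omega> D A" and u: "u \<in> D" and v: "v \<in> D"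
  shows "op_inner \<Omega> A (\<lambda>x. 1/2 * (u x + v x)) (\<lambda>x. v x - u x)
    = 1/2 * (op_norm \<Omega> A v)\<^sup>2 - 1/2 * (op_norm \<Omega> A u)\<^sup>2"
proof -
  let ?d = "\<lambda>x. 1 * v x + (- 1) * u x" and ?m = "\<lambda>x. 1/2 * u x + 1/2 * v x"
  have d: "?d \<in> D"
    by (rule linear_operator_on_lincomb(1)[OF A v u])
  have "op_inner \<Omega> A ?m ?d = 1/2 * op_inner \<Omega> A v v - 1/2 * op_inner \<Omega> A u u"
    unfolding op_inner_lincomb_left[OF A u v d] op_inner_lincomb_right[OF A v u v]
      op_inner_lincomb_right[OF A v u u] op_inner_commute[OF sa u v] by (simp add: field_simps)
  moreover have "?m = (\<lambda>x. 1/2 * (u x + v x))"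
    by (simp add: distrib_left)
  ultimately show ?thesis
    by (simp add: op_norm_power2[OF nn u] op_norm_power2[OF nn v])
qed

text \<open>Integrate \<open>e * \<mu>\<close>, inserting one equation for each factor. In the
  schemes \<open>h\<close> is \<open>L w\<close>, \<open>e\<close> is the difference quotient of
  \<phi>, and \<open>g\<close> is the explicit nonlinear term.\<close>

lemma gradient_flow_dissipation:
  assumes M: "linear_operator_on \<Omega> D M" and nn: "nonnegative_on \<Omega> D M" and \<mu>: "\<mu> \<in> D"
    and h: "h \<in> L2_on \<Omega>" and e: "e \<in> L2_on \<Omega>"
    and ge: "integrable (lebesgue_on \<Omega>) (\<lambda>x. g x * e x)"
    and e_eq: "AE x in lebesgue_on \<Omega>. e x = - M \<mu> x"
    and \<mu>_eq: "AE x in lebesgue_on \<Omega>. \<mu> x = h x + r * g x"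
  shows "L2_inner \<Omega> h e + r * (LINT x|lebesgue_on \<Omega>. g x * e x) \<le> 0"
proof -
  note he = L2_on_integrable_mult[OF h e]
  note M\<mu> = L2_on_integrable_mult[OF linear_operator_on_L2(2)[OF M \<mu>] linear_operator_on_L2(1)[OF M \<mu>]]
  have "L2_inner \<Omega> h e + r * (LINT x|lebesgue_on \<Omega>. g x * e x)
      = (LINT x|lebesgue_on \<Omega>. h x * e x + r * (g x * e x))"
    unfolding L2_inner_def using he ge by simp
  also have "\<dots> = (LINT x|lebesgue_on \<Omega>. - (M \<mu> x * \<mu> x))"
  proof (rule integral_cong_AE)
    \<comment> \<open>Only the product of \<open>g\<close> and \<open>e\<close> is controlled, so
      measurability is read off from its integrability.\<close>
    show "(\<lambda>x. h x * e x + r * (g x * e x)) \<in> borel_measurable (lebesgue_on \<Omega>)"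
      by (intro borel_measurable_integrable Bochner_Integration.integrable_add integrable_mult_right he ge)
    show "(\<lambda>x. - (M \<mu> x * \<mu> x)) \<in> borel_measurable (lebesgue_on \<Omega>)"
      by (intro borel_measurable_integrable Bochner_Integration.integrable_minus M\<mu>)
    show "AE x in lebesgue_on \<Omega>. h x * e x + r * (g x * e x) = - (M \<mu> x * \<mu> x)"
      using e_eq \<mu>_eq by eventually_elim (simp add: algebra_simps)
  qed
  also have "\<dots> = - L2_inner \<Omega> (M \<mu>) \<mu>"
    by (simp add: L2_inner_def)
  also have "\<dots> \<le> 0"
    using nn \<mu> by (simp add: nonnegative_on_def)
  finally show ?thesis .
qed

text \<open>The common core of both schemes, which differ only in \<open>w\<close>, \<open>r\<close>
  and \<open>g\<close>. The hypothesis \<open>w_ge\<close> isolates the estimate for the quadratic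
  energy that depends on the choice of \<open>w\<close>.\<close>

lemma rlm_energy_step:
  assumes L: "linear_operator_on \<Omega> D\<^sub>L L"
    and M: "linear_operator_on \<Omega> D\<^sub>M M" "nonnegative_on \<Omega> D\<^sub>M M"
    and dt: "dt > 0"
    and F: "integrable (lebesgue_on \<Omega>) (Fn n)" "integrable (lebesgue_on \<Omega>) (Fn (n+1))"
    and \<phi>: "\<phi> n \<in> D\<^sub>L" "\<phi> (n+1) \<in> D\<^sub>L" and w: "w \<in> D\<^sub>L" and \<mu>: "\<mu> \<in> D\<^sub>M"
    and ge: "integrable (lebesgue_on \<Omega>) (\<lambda>x. g x * ((\<phi> (n+1) x - \<phi> n x) / dt))"
    and e_eq: "AE x in lebesgue_on \<Omega>. (\<phi> (n+1) x - \<phi> n x) / dt = - M \<mu> x"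
    and \<mu>_eq: "AE x in lebesgue_on \<Omega>. \<mu> x = L w x + r * g x"
    and q_eq: "(LINT x|lebesgue_on \<Omega>. (Fn (n+1) x - Fn n x) / dt)
        + \<alpha> * (((q (n+1))\<^sup>2 - (q n)\<^sup>2) / dt)
      = r * (LINT x|lebesgue_on \<Omega>. g x * ((\<phi> (n+1) x - \<phi> n x) / dt))"
    and w_ge: "1/2 * (op_norm \<Omega> L (\<phi> (n+1)))\<^sup>2 - 1/2 * (op_norm \<Omega> L (\<phi> n))\<^sup>2
      \<le> op_inner \<Omega> L w (\<lambda>x. \<phi> (n+1) x - \<phi> n x)"
  shows "rlm_energy \<Omega> L \<alpha> Fn \<phi> q (n+1) - rlm_energy \<Omega> L \<alpha> Fn \<phi> q n \<le> 0"
proof -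
  let ?e = "\<lambda>x. (\<phi> (n+1) x - \<phi> n x) / dt"
  \<comment> \<open>As a linear combination of two time levels, the quotient stays in
    \<open>D\<^sub>L\<close> and is therefore square integrable.\<close>
  have "?e = (\<lambda>x. (1/dt) * \<phi> (n+1) x + (- 1/dt) * \<phi> n x)"
    by (simp add: diff_divide_distrib)
  then have "?e \<in> D\<^sub>L"
    using linear_operator_on_lincomb(1)[OF L \<phi>(2) \<phi>(1), of "1/dt" "- 1/dt"] by simp
  then have e: "?e \<in> L2_on \<Omega>"
    by (rule linear_operator_on_L2(1)[OF L])
  have "L2_inner \<Omega> (L w) ?e = op_inner \<Omega> L w (\<lambda>x. \<phi> (n+1) x - \<phi> n x) / dt"
    by (simp add: L2_inner_def op_inner_def)
  moreover have "(LINT x|lebesgue_on \<Omega>. (Fn (n+1) x - Fn n x) / dt)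
      = ((LINT x|lebesgue_on \<Omega>. Fn (n+1) x) - (LINT x|lebesgue_on \<Omega>. Fn n x)) / dt"
    using dt F by simp
  \<comment> \<open>Read from right to left, \<open>q_eq\<close> trades the nonlinear term for the
    increments of \<open>Fn\<close> and of \<alpha> times the square of \<open>q\<close>; all terms
    then share the denominator \<open>dt\<close>.\<close>
  ultimately have "(op_inner \<Omega> L w (\<lambda>x. \<phi> (n+1) x - \<phi> n x)
      + ((LINT x|lebesgue_on \<Omega>. Fn (n+1) x) - (LINT x|lebesgue_on \<Omega>. Fn n x))
      + \<alpha> * ((q (n+1))\<^sup>2 - (q n)\<^sup>2)) / dt \<le> 0"
    using gradient_flow_dissipation[OF M \<mu> linear_operator_on_L2(2)[OF L w] e ge e_eq \<mu>_eq]
    unfolding q_eq[symmetric] by (simp only: add_divide_distrib times_divide_eq_right add.assoc)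
  then have "op_inner \<Omega> L w (\<lambda>x. \<phi> (n+1) x - \<phi> n x)
      + ((LINT x|lebesgue_on \<Omega>. Fn (n+1) x) - (LINT x|lebesgue_on \<Omega>. Fn n x))
      + \<alpha> * ((q (n+1))\<^sup>2 - (q n)\<^sup>2) \<le> 0"
    using dt by (simp add: divide_le_0_iff)
  \<comment> \<open>\<open>w_ge\<close> replaces the pairing by the increment of the quadratic
    energy, and the constants \<open>- 1\<close> in the two energies cancel.\<close>
  then show ?thesis
    using w_ge unfolding rlm_energy_def by (simp add: algebra_simps)
qed

theorem theorem3p1:
  fixes \<Omega> :: "(real^'d) set"
    and D\<^sub>L D\<^sub>M :: "(real^'d \<Rightarrow> real) set"
    and L M :: "(real^'d \<Rightarrow> real) \<Rightarrow> (real^'d \<Rightarrow> real)"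
    and F f :: "real \<Rightarrow> real"
    and \<alpha> dt :: real
    and Fn \<phi> :: "int \<Rightarrow> real^'d \<Rightarrow> real"
    and q :: "int \<Rightarrow> real"
  assumes "open \<Omega>" and "connected \<Omega>" and "\<Omega> \<noteq> {}" and "bounded \<Omega>"
    and "\<alpha> \<ge> 0" and "dt > 0"
    and "linear_operator_on \<Omega> D\<^sub>L L" and "self_adjoint_on \<Omega> D\<^sub>L L" and "nonnegative_on \<Omega> D\<^sub>L L"
    and "linear_operator_on \<Omega> D\<^sub>M M" and "self_adjoint_on \<Omega> D\<^sub>M M" and "nonnegative_on \<Omega> D\<^sub>M M"
    and "\<And>s. (F has_real_derivative f s) (at s)"
    and "\<And>n. n \<ge> 0 \<Longrightarrow> integrable (lebesgue_on \<Omega>) (Fn n)"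
    and "q 0 = 1"
  shows "(\<forall>n\<ge>0. rlm_bdf1 \<Omega> D\<^sub>L L D\<^sub>M M f \<alpha> dt Fn \<phi> q n \<longrightarrow>
            rlm_energy \<Omega> L \<alpha> Fn \<phi> q (n+1) - rlm_energy \<Omega> L \<alpha> Fn \<phi> q n \<le> 0) \<and>
         (\<forall>n\<ge>0. rlm_cn \<Omega> D\<^sub>L L D\<^sub>M M f \<alpha> dt Fn \<phi> q n \<longrightarrow>
            rlm_energy \<Omega> L \<alpha> Fn \<phi> q (n+1) - rlm_energy \<Omega> L \<alpha> Fn \<phi> q n \<le> 0)"
proof (intro conjI allI impI)
  note L = assms(7-9) and M = assms(10,12) and F = assms(14)
  fix n :: int
  assume n: "n \<ge> 0"
  have Fn: "integrable (lebesgue_on \<Omega>) (Fn n)" "integrable (lebesgue_on \<Omega>) (Fn (n+1))"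
    using F n by auto
  {
    assume "rlm_bdf1 \<Omega> D\<^sub>L L D\<^sub>M M f \<alpha> dt Fn \<phi> q n"
    then obtain \<mu> where \<phi>: "\<phi> n \<in> D\<^sub>L" "\<phi> (n+1) \<in> D\<^sub>L" and \<mu>: "\<mu> \<in> D\<^sub>M"
      and eqs: "integrable (lebesgue_on \<Omega>) (\<lambda>x. f (\<phi> n x) * ((\<phi> (n+1) x - \<phi> n x) / dt))"
        "AE x in lebesgue_on \<Omega>. (\<phi> (n+1) x - \<phi> n x) / dt = - M \<mu> x"
        "AE x in lebesgue_on \<Omega>. \<mu> x = L (\<phi> (n+1)) x + q (n+1) * f (\<phi> n x)"
        "(LINT x|lebesgue_on \<Omega>. (Fn (n+1) x - Fn n x) / dt)
          + \<alpha> * (((q (n+1))\<^sup>2 - (q n)\<^sup>2) / dt)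
          = q (n+1) * (LINT x|lebesgue_on \<Omega>. f (\<phi> n x) * ((\<phi> (n+1) x - \<phi> n x) / dt))"
      unfolding rlm_bdf1_def by blast
    \<comment> \<open>Instance \<open>w = \<phi> (n+1)\<close>, \<open>r = q (n+1)\<close>, with
      \<open>g\<close> the value of \<open>f\<close> at level \<open>n\<close>.\<close>
    show "rlm_energy \<Omega> L \<alpha> Fn \<phi> q (n+1) - rlm_energy \<Omega> L \<alpha> Fn \<phi> q n \<le> 0"
      by (rule rlm_energy_step[OF L(1) M \<open>dt > 0\<close> Fn \<phi> \<phi>(2) \<mu> eqs op_inner_implicit_ge[OF L \<phi>]])
  next
    assume "rlm_cn \<Omega> D\<^sub>L L D\<^sub>M M f \<alpha> dt Fn \<phi> q n"
    then obtain \<mu> where \<phi>: "\<phi> n \<in> D\<^sub>L" "\<phi> (n+1) \<in> D\<^sub>L" and \<mu>: "\<mu> \<in> D\<^sub>M"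
      and eqs: "integrable (lebesgue_on \<Omega>) (\<lambda>x. f (phi_bar \<phi> n x) * ((\<phi> (n+1) x - \<phi> n x) / dt))"
        "AE x in lebesgue_on \<Omega>. (\<phi> (n+1) x - \<phi> n x) / dt = - M \<mu> x"
        "AE x in lebesgue_on \<Omega>. \<mu> x = L (phi_half \<phi> n) x + q_half q n * f (phi_bar \<phi> n x)"
        "(LINT x|lebesgue_on \<Omega>. (Fn (n+1) x - Fn n x) / dt)
          + \<alpha> * (((q (n+1))\<^sup>2 - (q n)\<^sup>2) / dt)
          = q_half q n * (LINT x|lebesgue_on \<Omega>. f (phi_bar \<phi> n x) * ((\<phi> (n+1) x - \<phi> n x) / dt))"
      unfolding rlm_cn_def by blast
    have half: "phi_half \<phi> n \<in> D\<^sub>L"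
      using linear_operator_on_lincomb(1)[OF L(1) \<phi>, of "1/2" "1/2"]
      by (simp add: phi_half_def distrib_left)
    \<comment> \<open>For the midpoint the required bound holds with equality, so the only
      dissipation left is that of \<open>M\<close>.\<close>
    have "1/2 * (op_norm \<Omega> L (\<phi> (n+1)))\<^sup>2 - 1/2 * (op_norm \<Omega> L (\<phi> n))\<^sup>2
        \<le> op_inner \<Omega> L (phi_half \<phi> n) (\<lambda>x. \<phi> (n+1) x - \<phi> n x)"
      unfolding phi_half_def op_inner_midpoint[OF L \<phi>] by simp
    then show "rlm_energy \<Omega> L \<alpha> Fn \<phi> q (n+1) - rlm_energy \<Omega> L \<alpha> Fn \<phi> q n \<le> 0"
      by (rule rlm_energy_step[OF L(1) M \<open>dt > 0\<close> Fn \<phi> half \<mu> eqs])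
  }
qed

end
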